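(* Let $\mathcal{E}$ be a regular evolution algebra over any field $\mathbb{K}$, of (finite) dimension $n$ greater than two, with natural basis $B=\{e_1,\dots,e_n\}$ and structure matrix $M_B(\mathcal{E})=(a_{ij})_{i,j=1}^n$. Suppose that $\mathcal{E}$ has a subalgebra of codimension one. In this case, there necessarily exist distinct indices $p,q\in\{1,\dots,n\}$ such that $$\operatorname{rank}M_{p,q}\leq 1,$$ where $M_{p,q}$ denotes the submatrix of $M_B(\mathcal{E})$ formed by the $p$-th and $q$-th columns after removing the $p$-th and $q$-th rows. Conversely, if $\operatorname{rank}M_{p,q}\leq 1$, the existence of subalgebras of codimension one can be characterised as follows: (a) If $\operatorname{rank}M_{p,q}=1$, then at least one row of $M_{p,q}$ is non-zero; let $(\alpha,\beta)$ be such a row. In this case, $\mathcal{E}$ has a subalgebra of codimension one if and only if $$\alpha^2\beta\, a_{pp}+\beta^3a_{qp}=\alpha^3a_{pq}+\alpha\beta^2a_{qq},$$ and the corresponding subalgebra is given by $\operatorname{span}\{e_i,v : i\neq p,q\}$ with $v=\alpha e_p+\beta e_q$. (b) If $\operatorname{rank}M_{p,q}=0$, then the subalgebras of codimension one are $\operatorname{span}\{e_i,v : i\neq p,q\}$ where $v=e_p+\lambda e_q$ for any $\lambda\in\mathbb{K}^*$ satisfying the equation $$a_{qp}\lambda^3-a_{qq}\lambda^2+a_{pp}\lambda-a_{pq}=0,$$ and additionally, $\operatorname{span}\{e_i : i\neq q\}$ when $a_{pq}=0$ and $\operatorname{span}\{e_i : i\neq p\}$ when $a_{qp}=0$.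
   Context: An algebra over $\mathbb{K}$ is a $\mathbb{K}$-vector space with a bilinear product (not assumed associative or unital). A finite-dimensional evolution algebra over $\mathbb{K}$ is a finite-dimensional $\mathbb{K}$-algebra $\mathcal{E}$ which has a basis $B=\{e_1,\dots,e_n\}$, called a natural basis, such that $e_ie_j=0$ for all $i\neq j$. Writing $e_i^2=\sum_{j=1}^n a_{ij}e_j$, the matrix $M_B(\mathcal{E})=(a_{ij})_{i,j=1}^n$ is called the structure matrix of $\mathcal{E}$ relative to $B$. The evolution algebra $\mathcal{E}$ is regular if $\mathcal{E}=\mathcal{E}^2$ (where $\mathcal{E}^2$ is the linear span of all products), equivalently if $M_B(\mathcal{E})$ is non-singular. A subalgebra is a linear subspace closed under the product; it has codimension one if its dimension is $n-1$. By convention, and without loss of generality, the distinct indices $p,q$ are taken with $p<q$; thus the rows of $M_{p,q}$ are $(a_{ip},a_{iq})$ for $i\neq p,q$. The notation $\operatorname{span}\{e_i,v : i\neq p,q\}$ means the linear span of $v$ together with all $e_i$ with $i\neq p,q$. $\mathbb{K}^*=\mathbb{K}\setminus\{0\}$.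
   Formalization: In (a) and (b), "subalgebra of codimension one" is restricted to those containing all e_i with i≠p,q, since the literal claims fail (e.g. identity structure matrix, n=3); it is also proved that every codimension-one subalgebra is of this kind for some p<q with rank M_{p,q}≤1. *)

theory Defs
  imports "Jordan_Normal_Form.DL_Rank" "Jordan_Normal_Form.DL_Submatrix"
begin

definition mat_rank :: "'k::field mat \<Rightarrow> nat" where
  "mat_rank A = vec_space.rank (dim_row A) A"

locale nonassoc_algebra = vector_space scale
  for scale :: "'k::field \<Rightarrow> 'v::ab_group_add \<Rightarrow> 'v" (infixr \<open>*s\<close> 75) +
  fixes mult :: "'v \<Rightarrow> 'v \<Rightarrow> 'v" (infixl \<open>\<bullet>\<close> 70)
  assumes linear_mult_left: "Vector_Spaces.linear scale scale (\<lambda>x. x \<bullet> y)"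
    and linear_mult_right: "Vector_Spaces.linear scale scale (\<lambda>y. x \<bullet> y)"
begin

definition subalgebra :: "'v set \<Rightarrow> bool" where
  "subalgebra S \<longleftrightarrow> subspace S \<and> (\<forall>x\<in>S. \<forall>y\<in>S. x \<bullet> y \<in> S)"

definition algebra_square :: "'v set" where
  "algebra_square = span {x \<bullet> y | x y. True}"

end

text \<open>The natural basis is indexed by \<open>0, \<dots>, n - 1\<close>, matching the matrix indices of
  \<^typ>\<open>'a mat\<close>.\<close>

locale evolution_algebra = nonassoc_algebra scale mult
  for scale :: "'k::field \<Rightarrow> 'v::ab_group_add \<Rightarrow> 'v" (infixr \<open>*s\<close> 75)
    and mult :: "'v \<Rightarrow> 'v \<Rightarrow> 'v" (infixl \<open>\<bullet>\<close> 70) +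
  fixes n :: nat and e :: "nat \<Rightarrow> 'v"
  assumes inj_basis: "inj_on e {..<n}"
    and independent_basis: "independent (e ` {..<n})"
    and span_basis: "span (e ` {..<n}) = UNIV"
    and natural_basis: "\<lbrakk>i < n; j < n; i \<noteq> j\<rbrakk> \<Longrightarrow> e i \<bullet> e j = 0"
begin

definition structure_matrix :: "'k mat" where
  "structure_matrix = mat n n (\<lambda>(i, j). representation (e ` {..<n}) (e i \<bullet> e i) (e j))"

definition regular :: bool where
  "regular \<longleftrightarrow> algebra_square = UNIV"

definition codim_one_subalgebra :: "'v set \<Rightarrow> bool" where
  "codim_one_subalgebra S \<longleftrightarrow> subalgebra S \<and> dim S = n - 1"

text \<open>For \<open>p < q\<close> the rows are \<open>(a\<^sub>i\<^sub>p, a\<^sub>i\<^sub>q)\<close>, \<open>i \<noteq> p, q\<close>, in increasing order of \<open>i\<close>.\<close>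

definition pair_submatrix :: "nat \<Rightarrow> nat \<Rightarrow> 'k mat" where
  "pair_submatrix p q = submatrix structure_matrix (- {p, q}) {p, q}"

text \<open>The codimension-one subalgebras belonging to the pair \<open>p, q\<close>. The rank of
  \<^term>\<open>pair_submatrix p q\<close> says nothing about the other codimension-one subalgebras: for \<open>n = 3\<close>
  and structure matrix the identity, the span of \<open>e\<^sub>0, e\<^sub>1\<close> is a subalgebra and does not contain
  \<open>e\<^sub>2\<close>, although the submatrix for the pair \<open>0, 1\<close> is zero.\<close>

definition codim_one_subalgebras_at :: "nat \<Rightarrow> nat \<Rightarrow> 'v set set" where
  "codim_one_subalgebras_at p q =
     {S. codim_one_subalgebra S \<and> (\<forall>i<n. i \<noteq> p \<and> i \<noteq> q \<longrightarrow> e i \<in> S)}"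

end

end

theory Submission
  imports Defs
begin

text \<open>A codimension-one subspace is the kernel of a linear functional \<open>f\<close>. Regularity gives an index
  \<open>i\<close> with \<open>f(e\<^sub>i\<^sup>2) \<noteq> 0\<close>, and testing the kernel on products of vectors supported on two basis
  elements shows that \<open>f\<close> is then nonzero on at most one further basis vector. So the subalgebra
  contains all \<open>e\<^sub>i\<close> with \<open>i \<noteq> p, q\<close> and is the hyperplane of all \<open>x\<close> with \<open>\<beta> x\<^sub>p = \<alpha> x\<^sub>q\<close>, spanned by
  these \<open>e\<^sub>i\<close> and \<open>v = \<alpha> e\<^sub>p + \<beta> e\<^sub>q\<close>. Such a hyperplane is closed under the product iff it contains
  the \<open>e\<^sub>i\<^sup>2\<close>, which says that the rows of \<open>M\<^sub>p\<^sub>,\<^sub>q\<close> are proportional to \<open>(\<alpha>, \<beta>)\<close>, and \<open>v\<^sup>2\<close>, which is the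
  cubic equation.\<close>

section \<open>Rank conditions for matrices, read off the entries\<close>

no_notation Matrix.scalar_prod (infix \<open>\<bullet>\<close> 70)

text \<open>A matrix with two columns has rank below two exactly when its columns satisfy a
  nontrivial relation, that is, when it has a nonzero kernel vector (x, y). Linear dependence is a
  property of the set of columns, so two equal columns form a separate case.\<close>

lemma mat_rank_le_one_iff:
  fixes A :: "'k::field mat"
  assumes A: "dim_col A = 2"
  shows "mat_rank A \<le> 1 \<longleftrightarrow>
    (\<exists>x y. (x, y) \<noteq> (0, 0) \<and> (\<forall>i<dim_row A. A $$ (i, 0) * x + A $$ (i, 1) * y = 0))"
proof -
  interpret vec_space "TYPE('k)" "dim_row A" .
  have car: "A \<in> carrier_mat (dim_row A) 2" using A by auto
  have prod_iff: "A *\<^sub>v v = 0\<^sub>v (dim_row A) \<longleftrightarrow>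
      (\<forall>i<dim_row A. A $$ (i, 0) * v $ 0 + A $$ (i, 1) * v $ 1 = 0)"
    if "v \<in> carrier_vec 2" for v
    using that A by (auto simp: vec_eq_iff scalar_prod_def numeral_2_eq_2)
  have neq_iff: "v \<noteq> 0\<^sub>v 2 \<longleftrightarrow> (v $ 0, v $ 1) \<noteq> (0, 0)" if "v \<in> carrier_vec 2" for v :: "'k vec"
    using that by (auto simp: vec_eq_iff less_2_cases_iff)
  have kernel_iff: "(\<exists>v\<in>carrier_vec 2. v \<noteq> 0\<^sub>v 2 \<and> A *\<^sub>v v = 0\<^sub>v (dim_row A)) \<longleftrightarrow>
    (\<exists>x y. (x, y) \<noteq> (0, 0) \<and> (\<forall>i<dim_row A. A $$ (i, 0) * x + A $$ (i, 1) * y = 0))"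
    (is "?L \<longleftrightarrow> ?R")
  proof
    assume ?L
    then show ?R using prod_iff neq_iff by blast
  next
    assume ?R
    then obtain x y where xy: "(x, y) \<noteq> (0, 0)"
      "\<forall>i<dim_row A. A $$ (i, 0) * x + A $$ (i, 1) * y = 0" by blast
    define v where "v = vec 2 (\<lambda>i. if i = 0 then x else y)"
    have "v \<in> carrier_vec 2" "v $ 0 = x" "v $ 1 = y" by (auto simp: v_def)
    then show ?L using xy prod_iff[of v] neq_iff[of v] by auto
  qed
  have nd: "\<not> distinct (cols A) \<longleftrightarrow> col A 0 = col A 1"
  proof -
    have "cols A = [col A 0, col A 1]"
      using A by (simp add: cols_def numeral_2_eq_2)
    then show ?thesis by simp
  qed
  have "mat_rank A \<le> 1 \<longleftrightarrow> (\<exists>v\<in>carrier_vec 2. v \<noteq> 0\<^sub>v 2 \<and> A *\<^sub>v v = 0\<^sub>v (dim_row A))"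
  proof (cases "distinct (cols A)")
    case True
    have "mat_rank A \<le> 1 \<longleftrightarrow> lin_dep (set (cols A))"
      using lin_indpt_full_rank[OF car True] full_rank_lin_indpt[OF car _ True] rank_le_nc[OF car]
      unfolding mat_rank_def by (metis One_nat_def Suc_1 le_SucE not_less_eq_eq order_refl)
    also have "\<dots> \<longleftrightarrow> (\<exists>v\<in>carrier_vec 2. v \<noteq> 0\<^sub>v 2 \<and> A *\<^sub>v v = 0\<^sub>v (dim_row A))"
      using lin_depI[OF car _ _ _ True] lin_depE[OF car _ True] by metis
    finally show ?thesis .
  next
    case False
    then have eq: "col A 0 = col A 1" using nd by simp
    \<comment> \<open>Equal columns give the kernel vector (1, -1).\<close>
    have "A $$ (i, 0) * 1 + A $$ (i, 1) * (- 1) = 0" if "i < dim_row A" for i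
      using that A arg_cong[OF eq, of "\<lambda>v. v $ i"] by simp
    then have ex: "\<exists>x y. (x, y) \<noteq> (0, 0) \<and> (\<forall>i<dim_row A. A $$ (i, 0) * x + A $$ (i, 1) * y = 0)"
      by (metis Pair_inject zero_neq_one)
    \<comment> \<open>The rank is the size of a maximal independent set of columns, and here the set
      of columns has fewer than two elements.\<close>
    obtain S where S: "maximal S (\<lambda>T. T \<subseteq> set (cols A) \<and> lin_indpt T)"
      using maximal_exists_superset[of "set (cols A)" "\<lambda>T. T \<subseteq> set (cols A) \<and> lin_indpt T" "{}"]
      by (auto simp: finite_lin_indpt2)
    then have "card S \<le> card (set (cols A))" by (simp add: card_mono maximal_def)
    also have "\<dots> < 2"
      using False A card_length[of "cols A"] card_distinct[of "cols A"] by (metis cols_length nat_less_le)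
    finally have "mat_rank A \<le> 1"
      using rank_card_indpt[OF car S] by (simp add: mat_rank_def)
    then show ?thesis using ex kernel_iff by blast
  qed
  then show ?thesis using kernel_iff by simp
qed

text \<open>A nonzero entry lies in a nonzero column, which alone is an independent set and forces
  rank at least one.\<close>

lemma mat_rank_eq_zero_iff:
  fixes A :: "'k::field mat"
  shows "mat_rank A = 0 \<longleftrightarrow> (\<forall>i<dim_row A. \<forall>j<dim_col A. A $$ (i, j) = 0)"
proof -
  interpret vec_space "TYPE('k)" "dim_row A" .
  have car: "A \<in> carrier_mat (dim_row A) (dim_col A)" by auto
  show ?thesis
  proof
    assume rank: "mat_rank A = 0"
    show "\<forall>i<dim_row A. \<forall>j<dim_col A. A $$ (i, j) = 0"
    proof (intro allI impI, rule ccontr)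
      fix i j assume ij: "i < dim_row A" "j < dim_col A" "A $$ (i, j) \<noteq> 0"
      have col: "col A j \<in> set (cols A)" using ij by (auto simp: cols_def)
      have "col A j \<noteq> 0\<^sub>v (dim_row A)" using ij by (auto simp: vec_eq_iff)
      then have "lin_indpt {col A j}"
        using lin_dep_iff_in_span[of "{}" "col A j"] ij
        by (auto simp: span_empty finite_lin_indpt2)
      then show False using rank_ge_card_indpt[OF car, of "{col A j}"] col rank
        by (auto simp: mat_rank_def)
    qed
  next
    assume "\<forall>i<dim_row A. \<forall>j<dim_col A. A $$ (i, j) = 0"
    then have "A = 0\<^sub>m (dim_row A) (dim_col A)" by (intro eq_matI) auto
    then show "mat_rank A = 0" using rank_0I[of "dim_col A"] by (simp add: mat_rank_def)
  qed
qed

section \<open>Bilinearity and products of spans\<close>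

context nonassoc_algebra
begin

interpretation mult_left: Vector_Spaces.linear scale scale "\<lambda>x. x \<bullet> y" for y
  by (rule linear_mult_left)

interpretation mult_right: Vector_Spaces.linear scale scale "\<lambda>y. x \<bullet> y" for x
  by (rule linear_mult_right)

lemma mult_zero_left [simp]: "0 \<bullet> y = 0"
  by (rule mult_left.zero)

lemma mult_zero_right [simp]: "x \<bullet> 0 = 0"
  by (rule mult_right.zero)

lemma mult_add_left: "(x + y) \<bullet> z = x \<bullet> z + y \<bullet> z"
  by (rule mult_left.add)

lemma mult_add_right: "x \<bullet> (y + z) = x \<bullet> y + x \<bullet> z"
  by (rule mult_right.add)

lemma mult_scale_left: "(c *s x) \<bullet> y = c *s (x \<bullet> y)"
  by (rule mult_left.scale)

lemma mult_scale_right: "x \<bullet> (c *s y) = c *s (x \<bullet> y)"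
  by (rule mult_right.scale)

lemmas mult_bilinear = mult_add_left mult_add_right mult_scale_left mult_scale_right

text \<open>Bilinearity is used one argument at a time: first x varies against a fixed generator,
  then y varies. \<open>V\<close> is kept separate from \<open>span G\<close> so that
  \<open>G\<close> can also be the whole natural basis and \<open>V\<close> a proper
  subspace.\<close>

lemma mult_mem_of_span:
  assumes V: "subspace V" and prods: "\<And>g h. g \<in> G \<Longrightarrow> h \<in> G \<Longrightarrow> g \<bullet> h \<in> V"
    and "x \<in> span G" and "y \<in> span G"
  shows "x \<bullet> y \<in> V"
proof -
  have gen: "x \<bullet> h \<in> V" if "h \<in> G" for h
    using \<open>x \<in> span G\<close>
    by (induction rule: span_induct_alt)
      (auto simp: mult_bilinear intro!: subspace_0 subspace_add subspace_scale V prods that)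
  show ?thesis
    using \<open>y \<in> span G\<close>
    by (induction rule: span_induct_alt)
      (auto simp: mult_bilinear intro!: subspace_0 subspace_add subspace_scale V gen)
qed

lemma subalgebra_span_iff:
  "subalgebra (span G) \<longleftrightarrow> (\<forall>g\<in>G. \<forall>h\<in>G. g \<bullet> h \<in> span G)"
  unfolding subalgebra_def
  using mult_mem_of_span[OF subspace_span, of G G] span_base[of _ G] by (auto simp: subspace_span)

end

section \<open>Coordinates in the natural basis and hyperplanes as kernels\<close>

context evolution_algebra
begin

sublocale finite_dimensional_vector_space scale "e ` {..<n}"
  by unfold_locales (auto simp: independent_basis span_basis)

lemma dimension_eq: "dimension = n"
  by (simp add: dimension_def card_image inj_basis)

text \<open>Indexing by numbers instead of basis vectors makes row i of the structure matrix the
  coordinates of \<open>e i \<bullet> e i\<close>.\<close>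

definition coord :: "'v \<Rightarrow> nat \<Rightarrow> 'k" where
  "coord x i = representation (e ` {..<n}) x (e i)"

lemma coord_zero [simp]: "coord 0 i = 0"
  by (simp add: coord_def representation_zero)

lemma coord_add [simp]: "coord (x + y) i = coord x i + coord y i"
  by (simp add: coord_def representation_add independent_basis span_basis)

lemma coord_scale [simp]: "coord (c *s x) i = c * coord x i"
  by (simp add: coord_def representation_scale independent_basis span_basis)

lemma coord_basis:
  assumes "i < n" "j < n"
  shows "coord (e i) j = (if i = j then 1 else 0)"
  using assms inj_onD[OF inj_basis, of i j]
  by (auto simp: coord_def representation_basis independent_basis)

lemma sum_coord: "(\<Sum>i<n. coord x i *s e i) = x"
proof -
  have "(\<Sum>b\<in>e ` {..<n}. representation (e ` {..<n}) x b *s b) = x"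
    by (rule sum_representation_eq) (auto simp: independent_basis span_basis)
  then show ?thesis
    by (simp add: sum.reindex inj_basis coord_def)
qed

lemma structure_matrix_eq_coord:
  "i < n \<Longrightarrow> j < n \<Longrightarrow> structure_matrix $$ (i, j) = coord (e i \<bullet> e i) j"
  by (simp add: structure_matrix_def coord_def)

lemma linear_functional_eq_sum:
  assumes f: "Vector_Spaces.linear scale (*) f"
  shows "f x = (\<Sum>i<n. coord x i * f (e i))"
proof -
  interpret f: Vector_Spaces.linear scale "(*)" f by (rule f)
  have "f x = f (\<Sum>i<n. coord x i *s e i)" by (simp only: sum_coord)
  also have "\<dots> = (\<Sum>i<n. coord x i * f (e i))" by (simp add: f.sum f.scale)
  finally show ?thesis .
qed

text \<open>A basis of S extends to a basis of the whole space by a single vector b, and f is the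
  coordinate at b.\<close>

lemma hyperplane_eq_kernel:
  assumes S: "subspace S" and dim: "dim S = n - 1" and n: "n > 0"
  obtains f where "Vector_Spaces.linear scale (*) f" "S = {x. f x = 0}" "\<exists>i<n. f (e i) \<noteq> 0"
proof -
  obtain A where A: "A \<subseteq> S" "independent A" "S \<subseteq> span A" "card A = n - 1"
    using basis_exists[of S] dim by metis
  have spanA: "span A = S" using A S by (metis span_subspace)
  define A' where "A' = extend_basis A"
  have A': "independent A'" "A \<subseteq> A'" "span A' = UNIV"
    using A(2) extend_basis_superset independent_extend_basis span_extend_basis
    by (auto simp: A'_def)
  have "card A' = n"
    using dim_eq_card[of A' UNIV] A' dimension_eq by (simp add: dimension_def)
  then have "A \<noteq> A'" using A(4) n by auto
  then obtain b where b: "b \<in> A'" "b \<notin> A" using A'(2) by blast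
  have finA: "finite A" "finite A'" using A(2) A'(1) finiteI_independent by auto
  \<comment> \<open>Counting shows that b is the only added vector: the two bases have n - 1 and n
    elements.\<close>
  have ins: "insert b A = A'"
    using card_subset_eq[OF finA(2), of "insert b A"] b A' finA A(4) n \<open>card A' = n\<close> by auto
  define f where "f x = representation A' x b" for x
  have lin: "Vector_Spaces.linear scale (*) f"
    unfolding f_def using linear_representation[OF A'(1) A'(3)] .
  interpret f: Vector_Spaces.linear scale "(*)" f by (rule lin)
  have fA: "f x = 0" if "x \<in> A" for x
    using that b A' by (auto simp: f_def representation_basis)
  have fb: "f b = 1" using b A' by (auto simp: f_def representation_basis)
  have "f x = 0" if "x \<in> span A" for x
    using that by (induction rule: span_induct_alt) (auto simp: f.zero f.add f.scale fA)
  moreover have "x \<in> span A" if "f x = 0" for x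
  proof -
    have "x \<in> span (insert b A)" using A'(3) ins by simp
    then obtain k where k: "x - k *s b \<in> span A" by (auto simp: span_insert)
    then have "f (x - k *s b) = 0" using calculation by blast
    then have "k = 0" using that fb by (simp add: f.diff f.scale)
    then show ?thesis using k by simp
  qed
  ultimately have ker: "S = {x. f x = 0}" using spanA by auto
  have "\<exists>i<n. f (e i) \<noteq> 0"
  proof (rule ccontr)
    assume "\<not> ?thesis"
    then have "f b = 0" using linear_functional_eq_sum[OF lin, of b] by simp
    then show False using fb by simp
  qed
  with lin ker show thesis by (rule that)
qed

section \<open>Regularity and the support of the defining functional\<close>

text \<open>Mixed products of basis vectors vanish, so the squares \<open>e i \<bullet> e i\<close>
  span the square of the algebra; a proper subspace cannot contain them all.\<close>

lemma regular_imp_square_notin: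
  assumes "regular" and S: "subspace S" "S \<noteq> UNIV"
  shows "\<exists>i<n. e i \<bullet> e i \<notin> S"
proof (rule ccontr)
  assume "\<not> ?thesis"
  then have sq: "e i \<bullet> e i \<in> S" if "i < n" for i using that by blast
  have "e i \<bullet> e j \<in> S" if "i < n" "j < n" for i j
    using that sq natural_basis[of i j] subspace_0[OF S(1)] by (cases "i = j") auto
  then have "x \<bullet> y \<in> S" for x y
    using mult_mem_of_span[OF S(1), of "e ` {..<n}" x y] span_basis by auto
  then have "algebra_square \<subseteq> S"
    unfolding algebra_square_def by (intro span_minimal S) auto
  then show False using assms by (auto simp: regular_def)
qed

text \<open>A square \<open>e i \<bullet> e i\<close> outside S is the obstruction: two further
  basis vectors outside the kernel would give elements of S whose product is a nonzero multiple of
  that square.\<close>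

lemma codim_one_subalgebra_functional_support:
  assumes reg: "regular" and n: "n > 1"
    and f: "Vector_Spaces.linear scale (*) f" "\<exists>i<n. f (e i) \<noteq> 0"
    and S: "S = {x. f x = 0}" "subalgebra S"
  obtains p q where "p < q" "q < n" "\<And>i. i < n \<Longrightarrow> i \<noteq> p \<Longrightarrow> i \<noteq> q \<Longrightarrow> f (e i) = 0"
proof -
  interpret f: Vector_Spaces.linear scale "(*)" f by (rule f(1))
  have S_mult: "f (x \<bullet> y) = 0" if "f x = 0" "f y = 0" for x y
  proof -
    have "x \<in> S" "y \<in> S" using that by (simp_all add: S(1))
    then have "x \<bullet> y \<in> S" using S(2) by (simp add: subalgebra_def)
    then show ?thesis by (simp add: S(1))
  qed
  obtain i where i: "i < n" "f (e i \<bullet> e i) \<noteq> 0"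
  proof -
    have "subspace S" using S(2) by (simp add: subalgebra_def)
    moreover have "S \<noteq> UNIV" using f(2) by (auto simp: S(1))
    ultimately show thesis using regular_imp_square_notin[OF reg, of S] that by (auto simp: S(1))
  qed
  \<comment> \<open>Otherwise \<open>e i\<close> would lie in S, and so would its square.\<close>
  have fi: "f (e i) \<noteq> 0" using i S_mult by blast
  have no_pair: "f (e j) = 0 \<or> f (e k) = 0"
    if "j < n" "k < n" "i \<noteq> j" "i \<noteq> k" "j \<noteq> k" for j k
  proof -
    \<comment> \<open>Two elements of the kernel whose product is a multiple of \<open>e\<^sub>i\<^sup>2\<close>.\<close>
    let ?x = "f (e j) *s e i + (- f (e i)) *s e j"
    let ?y = "f (e k) *s e i + (- f (e i)) *s e k"
    have "f ?x = 0" "f ?y = 0" by (simp_all only: f.add f.scale) auto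
    then have "f (?x \<bullet> ?y) = 0" by (rule S_mult)
    moreover have "?x \<bullet> ?y = (f (e j) * f (e k)) *s (e i \<bullet> e i)"
      using that i natural_basis[of i k] natural_basis[of j i] natural_basis[of j k]
      by (simp only: mult_bilinear) (simp add: mult.commute)
    ultimately show ?thesis using i by (simp add: f.scale)
  qed
  obtain j where j: "j < n" "j \<noteq> i" "\<And>k. k < n \<Longrightarrow> k \<noteq> i \<Longrightarrow> k \<noteq> j \<Longrightarrow> f (e k) = 0"
  proof (cases "\<exists>j<n. j \<noteq> i \<and> f (e j) \<noteq> 0")
    case True
    then show thesis using that no_pair by metis
  next
    case False
    \<comment> \<open>If only \<open>e i\<close> lies outside the kernel, any other index completes
      the pair; n > 1 provides one.\<close>
    have "(if i = 0 then 1 else 0) < n" "(if i = 0 then 1 else 0) \<noteq> i" using n by auto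
    then show thesis using that False by blast
  qed
  show thesis
  proof (cases "i < j")
    case True then show thesis using that[of i j] i j by blast
  next
    case False then show thesis using that[of j i] i j by (metis nat_neq_iff)
  qed
qed

section \<open>Hyperplanes containing all basis vectors outside a pair\<close>

text \<open>The parameters are homogeneous: away from (0, 0) only the ratio of \<alpha> and \<beta>
  matters. Thus (1, 0) and (0, 1) include the spans that omit \<open>e q\<close> and
  \<open>e p\<close>.\<close>

definition pair_hyperplane :: "nat \<Rightarrow> nat \<Rightarrow> 'k \<Rightarrow> 'k \<Rightarrow> 'v set" where
  "pair_hyperplane p q \<alpha> \<beta> = span (insert (\<alpha> *s e p + \<beta> *s e q) (e ` ({..<n} - {p, q})))"

lemma sum_split_pair:
  fixes g :: "nat \<Rightarrow> 'b::comm_monoid_add"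
  assumes "p < q" "q < n"
  shows "(\<Sum>i<n. g i) = g p + g q + (\<Sum>i\<in>{..<n} - {p, q}. g i)"
proof -
  have "(\<Sum>i<n. g i) = (\<Sum>i\<in>{p, q}. g i) + (\<Sum>i\<in>{..<n} - {p, q}. g i)"
    using assms sum.subset_diff[of "{p, q}" "{..<n}" g] by (simp add: add.commute)
  then show ?thesis using assms by simp
qed

context
  fixes p q :: nat
  assumes pq: "p < q" "q < n"
begin

text \<open>The other basis vectors are all available, so only the pair of coordinates at p and q
  matters; it must be proportional to (\<alpha>, \<beta>). The cross-multiplied form also covers
  \<alpha> = 0 and \<beta> = 0.\<close>

lemma mem_pair_hyperplane_iff:
  assumes nz: "(\<alpha>, \<beta>) \<noteq> (0, 0)"
  shows "x \<in> pair_hyperplane p q \<alpha> \<beta> \<longleftrightarrow> coord x p * \<beta> = coord x q * \<alpha>"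
proof
  assume "x \<in> pair_hyperplane p q \<alpha> \<beta>"
  then show "coord x p * \<beta> = coord x q * \<alpha>"
    unfolding pair_hyperplane_def using pq
    by (induction rule: span_induct_alt) (auto simp: coord_basis algebra_simps split: if_splits)
next
  assume eq: "coord x p * \<beta> = coord x q * \<alpha>"
  define v where "v = \<alpha> *s e p + \<beta> *s e q"
  have mem: "e i \<in> pair_hyperplane p q \<alpha> \<beta>" if "i \<in> {..<n} - {p, q}" for i
    unfolding pair_hyperplane_def using that by (intro span_base) auto
  have v: "t *s v \<in> pair_hyperplane p q \<alpha> \<beta>" for t
    unfolding pair_hyperplane_def v_def by (intro span_scale span_base) auto
  \<comment> \<open>The factor t is the quotient of coordinates at whichever of p and q has a
    nonzero parameter.\<close>
  have "\<exists>t. coord x p *s e p + coord x q *s e q = t *s v"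
  proof (cases "\<alpha> = 0")
    case True
    then have "coord x p = 0" "\<beta> \<noteq> 0" using eq nz by auto
    then show ?thesis using True by (intro exI[of _ "coord x q / \<beta>"]) (simp add: v_def)
  next
    case False
    then have "coord x q = coord x p / \<alpha> * \<beta>" using eq by (simp add: field_simps)
    then show ?thesis using False
      by (intro exI[of _ "coord x p / \<alpha>"]) (simp add: v_def scale_right_distrib)
  qed
  then have "coord x p *s e p + coord x q *s e q \<in> pair_hyperplane p q \<alpha> \<beta>" using v by auto
  moreover have "(\<Sum>i\<in>{..<n} - {p, q}. coord x i *s e i) \<in> pair_hyperplane p q \<alpha> \<beta>"
    using mem unfolding pair_hyperplane_def by (intro span_sum span_scale) auto
  ultimately have "(\<Sum>i<n. coord x i *s e i) \<in> pair_hyperplane p q \<alpha> \<beta>"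
    unfolding sum_split_pair[OF pq] pair_hyperplane_def by (rule span_add)
  then show "x \<in> pair_hyperplane p q \<alpha> \<beta>" by (simp only: sum_coord)
qed

lemma pair_hyperplane_scale:
  assumes "t \<noteq> 0" "(\<alpha>, \<beta>) \<noteq> (0, 0)"
  shows "pair_hyperplane p q (t * \<alpha>) (t * \<beta>) = pair_hyperplane p q \<alpha> \<beta>"
proof -
  have nz: "(t * \<alpha>, t * \<beta>) \<noteq> (0, 0)" using assms by auto
  show ?thesis
    unfolding set_eq_iff mem_pair_hyperplane_iff[OF nz] mem_pair_hyperplane_iff[OF assms(2)]
    using assms(1) by (simp add: mult.left_commute[of _ t])
qed

text \<open>The coordinates of v at p and q are \<alpha> and \<beta>, not both zero, so v is
  independent of the n - 2 remaining basis vectors.\<close>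

lemma dim_pair_hyperplane:
  assumes "(\<alpha>, \<beta>) \<noteq> (0, 0)"
  shows "dim (pair_hyperplane p q \<alpha> \<beta>) = n - 1"
proof -
  define v where "v = \<alpha> *s e p + \<beta> *s e q"
  define E where "E = e ` ({..<n} - {p, q})"
  have "coord x p = 0 \<and> coord x q = 0" if "x \<in> span E" for x
    using that pq unfolding E_def
    by (induction rule: span_induct_alt) (auto simp: coord_basis)
  moreover have "coord v p = \<alpha>" "coord v q = \<beta>" using pq by (auto simp: v_def coord_basis)
  ultimately have v: "v \<notin> span E" using assms by auto
  have "independent E"
    by (rule independent_mono[OF independent_basis]) (auto simp: E_def)
  then have ind: "independent (insert v E)" using v by (rule independent_insertI[rotated])
  have "card E = n - 2"
    using pq inj_on_subset[OF inj_basis, of "{..<n} - {p, q}"]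
    by (simp add: E_def card_image card_Diff_subset)
  moreover have finE: "finite E" and vE: "v \<notin> E" using v span_base[of v E] by (auto simp: E_def)
  ultimately have "card (insert v E) = n - 1"
    using card_insert_disjoint[OF finE vE] pq by simp
  then show ?thesis
    using dim_span_eq_card_independent[OF ind]
    by (simp add: pair_hyperplane_def v_def E_def)
qed

text \<open>Closure need only be tested on generators. All mixed products of generators vanish,
  which leaves the squares: those of the \<open>e i\<close> give the row conditions and that of v
  gives the cubic.\<close>

lemma pair_hyperplane_mem_iff:
  assumes nz: "(\<alpha>, \<beta>) \<noteq> (0, 0)"
  defines "a \<equiv> \<lambda>i j. structure_matrix $$ (i, j)"
  shows "pair_hyperplane p q \<alpha> \<beta> \<in> codim_one_subalgebras_at p q \<longleftrightarrow>
    (\<forall>i<n. i \<noteq> p \<and> i \<noteq> q \<longrightarrow> a i p * \<beta> = a i q * \<alpha>) \<and>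
    \<alpha>^2 * \<beta> * a p p + \<beta>^3 * a q p = \<alpha>^3 * a p q + \<alpha> * \<beta>^2 * a q q"
proof -
  define v where "v = \<alpha> *s e p + \<beta> *s e q"
  define E where "E = e ` ({..<n} - {p, q})"
  let ?H = "pair_hyperplane p q \<alpha> \<beta>"
  have H: "?H = span (insert v E)" by (simp add: pair_hyperplane_def v_def E_def)
  have mem: "e i \<in> ?H" if "i < n" "i \<noteq> p" "i \<noteq> q" for i
    using that unfolding H E_def by (intro span_base) auto
  have vv: "v \<bullet> v = \<alpha>^2 *s (e p \<bullet> e p) + \<beta>^2 *s (e q \<bullet> e q)"
    using pq natural_basis[of p q] natural_basis[of q p]
    by (simp add: v_def mult_bilinear power2_eq_square)
  have vE: "v \<bullet> e i = 0" "e i \<bullet> v = 0" if "i < n" "i \<noteq> p" "i \<noteq> q" for i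
    using that pq by (simp_all add: v_def mult_bilinear natural_basis)
  have EE: "e i \<bullet> e j = 0 \<or> e i \<bullet> e j = e i \<bullet> e i" if "i < n" "j < n" for i j
    using that natural_basis by (cases "i = j") auto
  have zero: "0 \<in> ?H" unfolding H by (rule span_zero)
  have "subalgebra ?H \<longleftrightarrow> v \<bullet> v \<in> ?H \<and> (\<forall>i<n. i \<noteq> p \<and> i \<noteq> q \<longrightarrow> e i \<bullet> e i \<in> ?H)"
    (is "_ \<longleftrightarrow> ?R")
  proof
    assume "subalgebra ?H"
    then show ?R using mem span_base[of v "insert v E"] unfolding subalgebra_def H by auto
  next
    assume R: ?R
    have "g \<bullet> h \<in> ?H" if "g \<in> insert v E" "h \<in> insert v E" for g h
      using that R vE EE zero unfolding E_def by (auto; metis)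
    then show "subalgebra ?H" unfolding H subalgebra_span_iff by blast
  qed
  also have "(\<forall>i<n. i \<noteq> p \<and> i \<noteq> q \<longrightarrow> e i \<bullet> e i \<in> ?H) \<longleftrightarrow>
      (\<forall>i<n. i \<noteq> p \<and> i \<noteq> q \<longrightarrow> a i p * \<beta> = a i q * \<alpha>)"
    using pq by (auto simp: mem_pair_hyperplane_iff[OF nz] a_def structure_matrix_eq_coord)
  \<comment> \<open>The coordinates of v squared are \<alpha>^2 \<open>a p p\<close> + \<beta>^2
    \<open>a q p\<close> at p and \<alpha>^2 \<open>a p q\<close> + \<beta>^2 \<open>a q q\<close>
    at q; the cubic equates \<beta> times the first with \<alpha> times the second.\<close>
  also have "v \<bullet> v \<in> ?H \<longleftrightarrow>
      \<alpha>^2 * \<beta> * a p p + \<beta>^3 * a q p = \<alpha>^3 * a p q + \<alpha> * \<beta>^2 * a q q"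
    using pq unfolding mem_pair_hyperplane_iff[OF nz] vv a_def
    by (simp add: structure_matrix_eq_coord algebra_simps power2_eq_square power3_eq_cube)
  finally show ?thesis
    using mem dim_pair_hyperplane[OF nz]
    unfolding codim_one_subalgebras_at_def codim_one_subalgebra_def by blast
qed

lemma codim_one_subalgebras_atE:
  assumes "S \<in> codim_one_subalgebras_at p q"
  obtains \<alpha> \<beta> where "(\<alpha>, \<beta>) \<noteq> (0, 0)" "S = pair_hyperplane p q \<alpha> \<beta>"
proof -
  have mem: "e i \<in> S" if "i < n" "i \<noteq> p" "i \<noteq> q" for i
    using assms that unfolding codim_one_subalgebras_at_def by auto
  have S: "subspace S" "dim S = n - 1"
    using assms
    unfolding codim_one_subalgebras_at_def codim_one_subalgebra_def subalgebra_def by auto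
  obtain f where f: "Vector_Spaces.linear scale (*) f" "S = {x. f x = 0}" "\<exists>i<n. f (e i) \<noteq> 0"
    using hyperplane_eq_kernel[OF S] pq by (metis gr_implies_not0 neq0_conv)
  have f0: "f (e i) = 0" if "i < n" "i \<noteq> p" "i \<noteq> q" for i using mem[OF that] f(2) by simp
  \<comment> \<open>These parameters come from the kernel vector
    \<open>f (e q) *s e p - f (e p) *s e q\<close>; f cannot vanish at both p and q, since it
    vanishes on all other basis vectors.\<close>
  have nz: "(f (e q), - f (e p)) \<noteq> (0, 0)" using f(3) f0 by auto
  have f_eq: "f x = coord x p * f (e p) + coord x q * f (e q)" for x
    unfolding linear_functional_eq_sum[OF f(1), of x] sum_split_pair[OF pq] using f0 by simp
  have "f x = 0 \<longleftrightarrow> x \<in> pair_hyperplane p q (f (e q)) (- f (e p))" for x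
    unfolding mem_pair_hyperplane_iff[OF nz] f_eq[of x] by (simp add: neg_eq_iff_add_eq_0)
  then have "S = pair_hyperplane p q (f (e q)) (- f (e p))" unfolding f(2) by blast
  with nz show thesis by (rule that)
qed

lemma codim_one_subalgebras_at_eq:
  defines "a \<equiv> \<lambda>i j. structure_matrix $$ (i, j)"
  shows "codim_one_subalgebras_at p q = {pair_hyperplane p q \<alpha> \<beta> | \<alpha> \<beta>. (\<alpha>, \<beta>) \<noteq> (0, 0) \<and>
    (\<forall>i<n. i \<noteq> p \<and> i \<noteq> q \<longrightarrow> a i p * \<beta> = a i q * \<alpha>) \<and>
    \<alpha>^2 * \<beta> * a p p + \<beta>^3 * a q p = \<alpha>^3 * a p q + \<alpha> * \<beta>^2 * a q q}"
    (is "_ = ?R")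
proof (intro equalityI subsetI)
  fix S assume S: "S \<in> codim_one_subalgebras_at p q"
  then obtain \<alpha> \<beta> where "(\<alpha>, \<beta>) \<noteq> (0, 0)" "S = pair_hyperplane p q \<alpha> \<beta>"
    by (rule codim_one_subalgebras_atE)
  then show "S \<in> ?R" using S pair_hyperplane_mem_iff[of \<alpha> \<beta>] unfolding a_def by blast
next
  fix S assume "S \<in> ?R"
  then show "S \<in> codim_one_subalgebras_at p q"
    using pair_hyperplane_mem_iff unfolding a_def by blast
qed

section \<open>The submatrix for the pair and its rank\<close>

text \<open>\<open>submatrix\<close> renumbers: a kept row i moves to the number of kept indices
  below i. The predicate \<open>P\<close> is arbitrary so that both rank criteria can be carried
  back to the original indices.\<close>

lemma
  shows dim_col_pair_submatrix: "dim_col (pair_submatrix p q) = 2"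
    and all_pair_submatrix_rows_iff:
      "(\<forall>r<dim_row (pair_submatrix p q).
          P (pair_submatrix p q $$ (r, 0)) (pair_submatrix p q $$ (r, 1))) \<longleftrightarrow>
       (\<forall>i<n. i \<noteq> p \<and> i \<noteq> q \<longrightarrow> P (structure_matrix $$ (i, p)) (structure_matrix $$ (i, q)))"
      (is "?L \<longleftrightarrow> ?R")
proof -
  let ?A = "structure_matrix" and ?I = "- {p, q}"
  have dims: "dim_row ?A = n" "dim_col ?A = n" by (simp_all add: structure_matrix_def)
  have "{j. j < n \<and> j \<in> {p, q}} = {p, q}" using pq by auto
  then show dc: "dim_col (pair_submatrix p q) = 2"
    using pq by (simp add: pair_submatrix_def dim_submatrix dims)
  \<comment> \<open>The order p < q makes p the column 0 and q the column 1.\<close>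
  have "{a \<in> {p, q}. a < p} = {}" "{a \<in> {p, q}. a < q} = {p}" using pq by auto
  then have cards: "card {a \<in> {p, q}. a < p} = 0" "card {a \<in> {p, q}. a < q} = 1"
    by (simp_all only: card.empty card_1_singleton_iff One_nat_def) auto
  have entry: "pair_submatrix p q $$ (card {a \<in> ?I. a < i}, 0) = ?A $$ (i, p)"
    "pair_submatrix p q $$ (card {a \<in> ?I. a < i}, 1) = ?A $$ (i, q)"
    "card {a \<in> ?I. a < i} < dim_row (pair_submatrix p q)"
    if "i < n" "i \<in> ?I" for i
  proof -
    show "pair_submatrix p q $$ (card {a \<in> ?I. a < i}, 0) = ?A $$ (i, p)"
      using submatrix_index_card[of i ?A p ?I "{p, q}"] that pq
      unfolding pair_submatrix_def cards dims by simp
    show "pair_submatrix p q $$ (card {a \<in> ?I. a < i}, 1) = ?A $$ (i, q)"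
      using submatrix_index_card[of i ?A q ?I "{p, q}"] that pq
      unfolding pair_submatrix_def cards dims by simp
    have "{a \<in> ?I. a < i} \<subset> {i. i < n \<and> i \<in> ?I}" using that by auto
    then show "card {a \<in> ?I. a < i} < dim_row (pair_submatrix p q)"
      unfolding pair_submatrix_def dim_submatrix dims by (intro psubset_card_mono) auto
  qed
  \<comment> \<open>Conversely, row r comes from the r-th element of the complement of {p, q}. That
    complement is infinite, so \<open>pick\<close> is always defined on it, and the bound on r keeps
    the index below n.\<close>
  have row: "\<exists>i. i < n \<and> i \<in> ?I \<and> r = card {a \<in> ?I. a < i}"
    if r: "r < dim_row (pair_submatrix p q)" for r
  proof (intro exI conjI)
    have inf: "infinite ?I" by simp
    show "pick ?I r < n"
      using r pick_le[of r n ?I] by (simp add: pair_submatrix_def dim_submatrix dims)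
    show "pick ?I r \<in> ?I" by (rule pick_in_set_inf[OF inf])
    show "r = card {a \<in> ?I. a < pick ?I r}" using card_pick_inf[OF inf] by simp
  qed
  show "?L \<longleftrightarrow> ?R"
  proof
    assume L: ?L
    show ?R
    proof (intro allI impI)
      fix i assume "i < n" "i \<noteq> p \<and> i \<noteq> q"
      then have i: "i < n" "i \<in> ?I" by auto
      show "P (?A $$ (i, p)) (?A $$ (i, q))"
        using L entry(3)[OF i] unfolding entry(1,2)[OF i, symmetric] by blast
    qed
  next
    assume R: ?R
    show ?L
    proof (intro allI impI)
      fix r assume "r < dim_row (pair_submatrix p q)"
      then obtain i where i: "i < n" "i \<in> ?I" "r = card {a \<in> ?I. a < i}" using row by blast
      show "P (pair_submatrix p q $$ (r, 0)) (pair_submatrix p q $$ (r, 1))"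
        unfolding i(3) entry(1,2)[OF i(1,2)] using R i(1,2) by blast
    qed
  qed
qed

lemma rank_pair_submatrix_le_one_iff:
  "mat_rank (pair_submatrix p q) \<le> 1 \<longleftrightarrow>
    (\<exists>x y. (x, y) \<noteq> (0, 0) \<and> (\<forall>i<n. i \<noteq> p \<and> i \<noteq> q \<longrightarrow>
       structure_matrix $$ (i, p) * x + structure_matrix $$ (i, q) * y = 0))"
  unfolding mat_rank_le_one_iff[OF dim_col_pair_submatrix]
  unfolding all_pair_submatrix_rows_iff[of "\<lambda>b c. b * x + c * y = 0" for x y] ..

lemma rank_pair_submatrix_eq_zero_iff:
  "mat_rank (pair_submatrix p q) = 0 \<longleftrightarrow>
    (\<forall>i<n. i \<noteq> p \<and> i \<noteq> q \<longrightarrow> structure_matrix $$ (i, p) = 0 \<and> structure_matrix $$ (i, q) = 0)"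
proof -
  have "(\<forall>j<2. g j = 0) \<longleftrightarrow> g 0 = 0 \<and> g 1 = 0" for g :: "nat \<Rightarrow> 'k"
    by (auto simp: less_2_cases_iff)
  then show ?thesis
    using all_pair_submatrix_rows_iff[of "\<lambda>b c. b = 0 \<and> c = 0"]
    by (simp add: mat_rank_eq_zero_iff dim_col_pair_submatrix)
qed

section \<open>Solving the conditions in rank one and rank zero\<close>

text \<open>The nonzero row (\<alpha>, \<beta>) fixes the ratio of any admissible parameters,
  leaving one candidate hyperplane. Rank one makes every other row proportional to it, so only the
  cubic remains to be tested.\<close>

lemma codim_one_subalgebras_at_rank_one:
  fixes \<alpha> \<beta> :: 'k and i :: nat
  defines "a \<equiv> \<lambda>i j. structure_matrix $$ (i, j)"
  assumes rank: "mat_rank (pair_submatrix p q) = 1"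
    and i: "i < n" "i \<noteq> p" "i \<noteq> q" and row: "(\<alpha>, \<beta>) = (a i p, a i q)" "(\<alpha>, \<beta>) \<noteq> (0, 0)"
  shows "codim_one_subalgebras_at p q =
    (if \<alpha>^2 * \<beta> * a p p + \<beta>^3 * a q p = \<alpha>^3 * a p q + \<alpha> * \<beta>^2 * a q q
     then {pair_hyperplane p q \<alpha> \<beta>} else {})"
proof -
  obtain x y where xy: "(x, y) \<noteq> (0, 0)"
    and rel: "\<And>j. j < n \<Longrightarrow> j \<noteq> p \<Longrightarrow> j \<noteq> q \<Longrightarrow> a j p * x + a j q * y = 0"
    using rank rank_pair_submatrix_le_one_iff unfolding a_def by auto
  have rel_i: "\<alpha> * x + \<beta> * y = 0" using rel[OF i] row by simp
  have rows: "a j p * \<beta> = a j q * \<alpha>" if "j < n" "j \<noteq> p" "j \<noteq> q" for j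
  proof -
    \<comment> \<open>As in Cramer's rule, the determinant of the two rows times x and times y is a
      combination of the two relations, hence zero; one of x, y is nonzero.\<close>
    have "(a j p * \<beta> - a j q * \<alpha>) * x =
        \<beta> * (a j p * x + a j q * y) - a j q * (\<alpha> * x + \<beta> * y)"
      "(a j p * \<beta> - a j q * \<alpha>) * y =
        a j p * (\<alpha> * x + \<beta> * y) - \<alpha> * (a j p * x + a j q * y)"
      by (simp_all add: algebra_simps)
    then show ?thesis using xy rel[OF that] rel_i by auto
  qed
  have eq: "pair_hyperplane p q \<gamma> \<delta> = pair_hyperplane p q \<alpha> \<beta>"
    if "(\<gamma>, \<delta>) \<noteq> (0, 0)" and \<gamma>\<delta>: "a i p * \<delta> = a i q * \<gamma>" for \<gamma> \<delta>
  proof -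
    have e: "\<alpha> * \<delta> = \<beta> * \<gamma>" using \<gamma>\<delta> row by simp
    obtain t where "\<gamma> = t * \<alpha>" "\<delta> = t * \<beta>"
    proof (cases "\<alpha> = 0")
      case True
      then show thesis using that[of "\<delta> / \<beta>"] e row(2) by auto
    next
      case False
      then show thesis using that[of "\<gamma> / \<alpha>"] e by (simp add: field_simps)
    qed
    then show ?thesis using pair_hyperplane_scale[of t \<alpha> \<beta>] row(2) that(1) by auto
  qed
  have "S = pair_hyperplane p q \<alpha> \<beta>" if "S \<in> codim_one_subalgebras_at p q" for S
    using that eq i unfolding codim_one_subalgebras_at_eq a_def by blast
  moreover have "pair_hyperplane p q \<alpha> \<beta> \<in> codim_one_subalgebras_at p q \<longleftrightarrow>
      \<alpha>^2 * \<beta> * a p p + \<beta>^3 * a q p = \<alpha>^3 * a p q + \<alpha> * \<beta>^2 * a q q"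
    using pair_hyperplane_mem_iff[OF row(2)] rows unfolding a_def by blast
  ultimately show ?thesis by auto
qed

lemma pair_hyperplane_one_zero: "pair_hyperplane p q 1 0 = span (e ` ({..<n} - {q}))"
proof -
  have "insert p ({..<n} - {p, q}) = {..<n} - {q}" using pq by auto
  then show ?thesis by (simp add: pair_hyperplane_def flip: image_insert)
qed

lemma pair_hyperplane_zero_one: "pair_hyperplane p q 0 1 = span (e ` ({..<n} - {p}))"
proof -
  have "insert q ({..<n} - {p, q}) = {..<n} - {p}" using pq by auto
  then show ?thesis by (simp add: pair_hyperplane_def flip: image_insert)
qed

text \<open>The row conditions become vacuous, so every ratio solving the cubic occurs. Normalising
  parameters to (1, l) or (0, 1) gives the three families, with l = 0 split off.\<close>

lemma codim_one_subalgebras_at_rank_zero: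
  defines "a \<equiv> \<lambda>i j. structure_matrix $$ (i, j)"
  assumes rank: "mat_rank (pair_submatrix p q) = 0"
  shows "codim_one_subalgebras_at p q =
    {pair_hyperplane p q 1 l | l. l \<noteq> 0 \<and> a q p * l^3 - a q q * l^2 + a p p * l - a p q = 0} \<union>
    (if a p q = 0 then {pair_hyperplane p q 1 0} else {}) \<union>
    (if a q p = 0 then {pair_hyperplane p q 0 1} else {})"
proof -
  have rows: "\<forall>i<n. i \<noteq> p \<and> i \<noteq> q \<longrightarrow> a i p * y = a i q * x" for x y
    using rank rank_pair_submatrix_eq_zero_iff by (simp add: a_def)
  have mem: "pair_hyperplane p q x y \<in> codim_one_subalgebras_at p q \<longleftrightarrow>
      x^2 * y * a p p + y^3 * a q p = x^3 * a p q + x * y^2 * a q q" if "(x, y) \<noteq> (0, 0)" for x y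
    using pair_hyperplane_mem_iff[OF that] rows unfolding a_def by blast
  have mem1: "pair_hyperplane p q 1 l \<in> codim_one_subalgebras_at p q \<longleftrightarrow>
      a q p * l^3 - a q q * l^2 + a p p * l - a p q = 0" for l
    using mem[of 1 l] by (simp add: algebra_simps)
  have mem2: "pair_hyperplane p q 0 1 \<in> codim_one_subalgebras_at p q \<longleftrightarrow> a q p = 0"
    using mem[of 0 1] by simp
  have mem3: "pair_hyperplane p q 1 0 \<in> codim_one_subalgebras_at p q \<longleftrightarrow> a p q = 0"
    using mem[of 1 0] by auto
  have "(\<exists>l. S = pair_hyperplane p q 1 l) \<or> S = pair_hyperplane p q 0 1"
    if S: "S \<in> codim_one_subalgebras_at p q" for S
  proof -
    obtain x y where xy: "(x, y) \<noteq> (0, 0)" "S = pair_hyperplane p q x y"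
      using codim_one_subalgebras_atE[OF S] by blast
    show ?thesis
    proof (cases "x = 0")
      case True
      then show ?thesis using xy pair_hyperplane_scale[of y 0 1] by auto
    next
      case False
      then show ?thesis using xy pair_hyperplane_scale[of x 1 "y / x"] by auto
    qed
  qed
  then show ?thesis using mem1 mem2 mem3 by (auto; metis)
qed

end

section \<open>Finding the pair for a given subalgebra\<close>

text \<open>The support of the functional places S in the family of a pair, and closure of S under
  the product then forces the rank bound.\<close>

lemma codim_one_subalgebra_pair:
  assumes reg: "regular" and n: "n > 1" and S: "codim_one_subalgebra S"
  obtains p q where "p < q" "q < n" "mat_rank (pair_submatrix p q) \<le> 1"
    "S \<in> codim_one_subalgebras_at p q"
proof -
  have S': "subalgebra S" "subspace S" "dim S = n - 1"
    using S unfolding codim_one_subalgebra_def subalgebra_def by auto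
  obtain f where f: "Vector_Spaces.linear scale (*) f" "S = {x. f x = 0}" "\<exists>i<n. f (e i) \<noteq> 0"
    using hyperplane_eq_kernel[OF S'(2,3)] n by auto
  obtain p q where pq: "p < q" "q < n"
    and supp: "\<And>i. i < n \<Longrightarrow> i \<noteq> p \<Longrightarrow> i \<noteq> q \<Longrightarrow> f (e i) = 0"
    using codim_one_subalgebra_functional_support[OF reg n f(1,3,2) S'(1)] by blast
  have at: "S \<in> codim_one_subalgebras_at p q"
    using S supp f(2) by (auto simp: codim_one_subalgebras_at_def)
  then obtain \<alpha> \<beta> where "(\<alpha>, \<beta>) \<noteq> (0, 0)"
    "\<forall>i<n. i \<noteq> p \<and> i \<noteq> q \<longrightarrow> structure_matrix $$ (i, p) * \<beta> = structure_matrix $$ (i, q) * \<alpha>"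
    unfolding codim_one_subalgebras_at_eq[OF pq] by blast
  \<comment> \<open>By the row conditions, (\<beta>, -\<alpha>) is a nonzero kernel vector of the
    submatrix.\<close>
  then have "mat_rank (pair_submatrix p q) \<le> 1"
    unfolding rank_pair_submatrix_le_one_iff[OF pq]
    by (intro exI[of _ \<beta>] exI[of _ "- \<alpha>"]) auto
  with pq at show thesis using that by blast
qed

end

text \<open>The rank cases describe the subalgebras belonging to a fixed pair. Since each
  codimension-one subalgebra belongs to some pair of rank at most one, together they account for all
  of them.\<close>

theorem proposition5:
  fixes scale :: "'k::field \<Rightarrow> 'v::ab_group_add \<Rightarrow> 'v" (infixr \<open>*s\<close> 75)
    and mult :: "'v \<Rightarrow> 'v \<Rightarrow> 'v"
    and n :: nat
    and e :: "nat \<Rightarrow> 'v"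
    and a :: "nat \<Rightarrow> nat \<Rightarrow> 'k"
    and span :: "'v set \<Rightarrow> 'v set"
    and rank_M :: "nat \<Rightarrow> nat \<Rightarrow> nat"
  assumes "evolution_algebra scale mult n e"
    and "evolution_algebra.regular scale mult"
    and "n > 2"
    and "a = (\<lambda>i j. evolution_algebra.structure_matrix scale mult n e $$ (i, j))"
    and "span = Modules.module.span scale"
    and "rank_M = (\<lambda>p q. mat_rank (evolution_algebra.pair_submatrix scale mult n e p q))"
  shows
    "((\<exists>S. evolution_algebra.codim_one_subalgebra scale mult n S) \<longrightarrow>
        (\<exists>p q. p < q \<and> q < n \<and> rank_M p q \<le> 1)) \<and>
     (\<forall>S. evolution_algebra.codim_one_subalgebra scale mult n S \<longrightarrow>
        (\<exists>p q. p < q \<and> q < n \<and> rank_M p q \<le> 1 \<and>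
           S \<in> evolution_algebra.codim_one_subalgebras_at scale mult n e p q)) \<and>
     (\<forall>p q. p < q \<and> q < n \<longrightarrow>
        (rank_M p q = 1 \<longrightarrow>
           (\<exists>i<n. i \<noteq> p \<and> i \<noteq> q \<and> (a i p, a i q) \<noteq> (0, 0)) \<and>
           (\<forall>\<alpha> \<beta>. (\<exists>i<n. i \<noteq> p \<and> i \<noteq> q \<and> (\<alpha>, \<beta>) = (a i p, a i q)) \<and> (\<alpha>, \<beta>) \<noteq> (0, 0) \<longrightarrow>
              (evolution_algebra.codim_one_subalgebras_at scale mult n e p q \<noteq> {} \<longleftrightarrow>
                 \<alpha>^2 * \<beta> * a p p + \<beta>^3 * a q p = \<alpha>^3 * a p q + \<alpha> * \<beta>^2 * a q q) \<and>
              (\<alpha>^2 * \<beta> * a p p + \<beta>^3 * a q p = \<alpha>^3 * a p q + \<alpha> * \<beta>^2 * a q q \<longrightarrow>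
                 evolution_algebra.codim_one_subalgebras_at scale mult n e p q =
                   {span (insert (\<alpha> *s e p + \<beta> *s e q) (e ` ({..<n} - {p, q})))}))) \<and>
        (rank_M p q = 0 \<longrightarrow>
           evolution_algebra.codim_one_subalgebras_at scale mult n e p q =
             {span (insert (e p + l *s e q) (e ` ({..<n} - {p, q}))) | l.
                l \<noteq> 0 \<and> a q p * l^3 - a q q * l^2 + a p p * l - a p q = 0} \<union>
             (if a p q = 0 then {span (e ` ({..<n} - {q}))} else {}) \<union>
             (if a q p = 0 then {span (e ` ({..<n} - {p}))} else {})))"
proof -
  interpret evolution_algebra scale mult n e by (rule assms(1))
  note a = assms(4) and sp = assms(5) and rk = assms(6)
  have reg: "regular" by (rule assms(2))
  have hyp: "span (insert (\<alpha> *s e p + \<beta> *s e q) (e ` ({..<n} - {p, q}))) =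
      pair_hyperplane p q \<alpha> \<beta>" for p q \<alpha> \<beta>
    by (simp add: sp pair_hyperplane_def)
  have hyp1: "span (insert (e p + l *s e q) (e ` ({..<n} - {p, q}))) = pair_hyperplane p q 1 l"
    for p q l using hyp[of 1 p l q] by simp
  have pair: "\<exists>p q. p < q \<and> q < n \<and> rank_M p q \<le> 1 \<and> S \<in> codim_one_subalgebras_at p q"
    if "codim_one_subalgebra S" for S
    using codim_one_subalgebra_pair[OF reg _ that] assms(3) unfolding rk
    by (metis One_nat_def Suc_lessD numeral_2_eq_2)
  have one: "(\<exists>i<n. i \<noteq> p \<and> i \<noteq> q \<and> (a i p, a i q) \<noteq> (0, 0)) \<and>
      (\<forall>\<alpha> \<beta>. (\<exists>i<n. i \<noteq> p \<and> i \<noteq> q \<and> (\<alpha>, \<beta>) = (a i p, a i q)) \<and> (\<alpha>, \<beta>) \<noteq> (0, 0) \<longrightarrow>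
        (codim_one_subalgebras_at p q \<noteq> {} \<longleftrightarrow>
           \<alpha>^2 * \<beta> * a p p + \<beta>^3 * a q p = \<alpha>^3 * a p q + \<alpha> * \<beta>^2 * a q q) \<and>
        (\<alpha>^2 * \<beta> * a p p + \<beta>^3 * a q p = \<alpha>^3 * a p q + \<alpha> * \<beta>^2 * a q q \<longrightarrow>
           codim_one_subalgebras_at p q =
             {span (insert (\<alpha> *s e p + \<beta> *s e q) (e ` ({..<n} - {p, q})))}))"
    if pq: "p < q" "q < n" and rank: "rank_M p q = 1" for p q
  proof (intro conjI allI impI)
    have r: "mat_rank (pair_submatrix p q) = 1" using rank by (simp add: rk)
    then show "\<exists>i<n. i \<noteq> p \<and> i \<noteq> q \<and> (a i p, a i q) \<noteq> (0, 0)"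
      using rank_pair_submatrix_eq_zero_iff[OF pq] unfolding a by auto
    fix \<alpha> \<beta>
    assume row: "(\<exists>i<n. i \<noteq> p \<and> i \<noteq> q \<and> (\<alpha>, \<beta>) = (a i p, a i q)) \<and> (\<alpha>, \<beta>) \<noteq> (0, 0)"
    then have at: "codim_one_subalgebras_at p q =
        (if \<alpha>^2 * \<beta> * a p p + \<beta>^3 * a q p = \<alpha>^3 * a p q + \<alpha> * \<beta>^2 * a q q
         then {pair_hyperplane p q \<alpha> \<beta>} else {})"
      using codim_one_subalgebras_at_rank_one[OF pq r] unfolding a by blast
    show "codim_one_subalgebras_at p q \<noteq> {} \<longleftrightarrow>
        \<alpha>^2 * \<beta> * a p p + \<beta>^3 * a q p = \<alpha>^3 * a p q + \<alpha> * \<beta>^2 * a q q"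
      unfolding at by simp
    assume "\<alpha>^2 * \<beta> * a p p + \<beta>^3 * a q p = \<alpha>^3 * a p q + \<alpha> * \<beta>^2 * a q q"
    then show "codim_one_subalgebras_at p q =
        {span (insert (\<alpha> *s e p + \<beta> *s e q) (e ` ({..<n} - {p, q})))}"
      unfolding at hyp by simp
  qed
  have zero: "codim_one_subalgebras_at p q =
      {span (insert (e p + l *s e q) (e ` ({..<n} - {p, q}))) | l.
         l \<noteq> 0 \<and> a q p * l^3 - a q q * l^2 + a p p * l - a p q = 0} \<union>
      (if a p q = 0 then {span (e ` ({..<n} - {q}))} else {}) \<union>
      (if a q p = 0 then {span (e ` ({..<n} - {p}))} else {})"
    if pq: "p < q" "q < n" and rank: "rank_M p q = 0" for p q
  proof -
    have "mat_rank (pair_submatrix p q) = 0" using rank by (simp add: rk)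
    from codim_one_subalgebras_at_rank_zero[OF pq this] show ?thesis
      unfolding hyp1 pair_hyperplane_one_zero[OF pq] pair_hyperplane_zero_one[OF pq]
      unfolding a sp .
  qed
  show ?thesis
  proof (intro conjI)
    show "(\<exists>S. codim_one_subalgebra S) \<longrightarrow> (\<exists>p q. p < q \<and> q < n \<and> rank_M p q \<le> 1)"
      using pair by blast
    show "\<forall>S. codim_one_subalgebra S \<longrightarrow>
        (\<exists>p q. p < q \<and> q < n \<and> rank_M p q \<le> 1 \<and> S \<in> codim_one_subalgebras_at p q)"
      using pair by blast
  qed (intro allI impI, elim conjE, intro conjI[where P = "_ \<longrightarrow> _"] impI; rule one zero; assumption)
qed

end
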